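(* If $T$ is a tensor product of the $R$-modules $M$ and $N$, with an $R$-bilinear map $\phi : M \times N \rightarrow T$ and a set $\{n_i\}_{i \in I}$ of generators of $N$, then for any finite set of pairs $(m_i, n_i) \in M \times N$ with $m_i \in M$ arbitrary, $\sum_i \phi(m_i, n_i) = 0$ if, and only if, there exist elements $m_j^\prime \in M$, $a_{ij} \in R$, such that $$\sum_j a_{ij} m_j^\prime = m_i \text{ for all } i$$ and $$\sum_i a_{ij} n_i = 0 \text{ for all } j.$$
   Context: $R$ is a commutative ring with one. A map $\phi : M \times N \rightarrow L$ from the (set-theoretic) product of two $R$-modules $M$, $N$ to an $R$-module $L$ is called ($R$-)bilinear if $\phi(rm, n) = \phi(m, rn) = r \cdot \phi(m, n)$, $\phi(m_1 + m_2, n) = \phi(m_1, n) + \phi(m_2, n)$ and $\phi(m, n_1 + n_2) = \phi(m, n_1) + \phi(m, n_2)$ for all $m, m_1, m_2 \in M$, $n, n_1, n_2 \in N$, $r \in R$. An $R$-module $T$ is a tensor product of two $R$-modules $M$, $N$, with $R$-bilinear map $\phi : M \times N \rightarrow T$, if for all bilinear maps $\psi : M \times N \rightarrow S$ to an $R$-module $S$ there is a unique $R$-module homomorphism $f : T \rightarrow S$ such that $\psi = f \circ \phi$.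
   Formalization: Here i runs over the whole index set I of the generators, with m_i = 0 outside the chosen finite set and each (a_ij)_i finitely supported; with i only in the finite set the claim fails (R = Z, M = Z/2, N = Z, generators 2 and 1, single pair (1, 2)). *)

theory Defs
  imports Complex_Main "HOL-Algebra.Module"
begin

text \<open>Modules are those of \<^locale>\<open>module\<close>, so the base ring is a commutative ring with one.\<close>

definition linear_maps ::
    "('r, 'x) ring_scheme \<Rightarrow> ('r, 'a, 'y) module_scheme \<Rightarrow> ('r, 'b, 'z) module_scheme \<Rightarrow> ('a \<Rightarrow> 'b) set"
  where "linear_maps R M N =
    {f \<in> carrier M \<rightarrow> carrier N.
       (\<forall>x \<in> carrier M. \<forall>y \<in> carrier M. f (x \<oplus>\<^bsub>M\<^esub> y) = f x \<oplus>\<^bsub>N\<^esub> f y) \<and>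
       (\<forall>r \<in> carrier R. \<forall>x \<in> carrier M. f (r \<odot>\<^bsub>M\<^esub> x) = r \<odot>\<^bsub>N\<^esub> f x)}"

definition bilinear_map ::
    "('r, 'x) ring_scheme \<Rightarrow> ('r, 'm, 'y) module_scheme \<Rightarrow> ('r, 'n, 'z) module_scheme \<Rightarrow>
     ('r, 'l, 'w) module_scheme \<Rightarrow> ('m \<times> 'n \<Rightarrow> 'l) \<Rightarrow> bool"
  where "bilinear_map R M N L \<phi> \<longleftrightarrow>
    \<phi> \<in> carrier M \<times> carrier N \<rightarrow> carrier L \<and>
    (\<forall>r \<in> carrier R. \<forall>m \<in> carrier M. \<forall>n \<in> carrier N.
       \<phi> (r \<odot>\<^bsub>M\<^esub> m, n) = r \<odot>\<^bsub>L\<^esub> \<phi> (m, n) \<and> \<phi> (m, r \<odot>\<^bsub>N\<^esub> n) = r \<odot>\<^bsub>L\<^esub> \<phi> (m, n)) \<and>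
    (\<forall>m\<^sub>1 \<in> carrier M. \<forall>m\<^sub>2 \<in> carrier M. \<forall>n \<in> carrier N.
       \<phi> (m\<^sub>1 \<oplus>\<^bsub>M\<^esub> m\<^sub>2, n) = \<phi> (m\<^sub>1, n) \<oplus>\<^bsub>L\<^esub> \<phi> (m\<^sub>2, n)) \<and>
    (\<forall>m \<in> carrier M. \<forall>n\<^sub>1 \<in> carrier N. \<forall>n\<^sub>2 \<in> carrier N.
       \<phi> (m, n\<^sub>1 \<oplus>\<^bsub>N\<^esub> n\<^sub>2) = \<phi> (m, n\<^sub>1) \<oplus>\<^bsub>L\<^esub> \<phi> (m, n\<^sub>2))"

text \<open>
  The universal property, tested against all modules whose elements have type \<open>'s\<close>.
  Homomorphisms are functions on carriers only; uniqueness is therefore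
  expressed for functions that are \<open>undefined\<close> off \<open>carrier T\<close>.
\<close>

definition tensor_product_wrt ::
    "'s itself \<Rightarrow> ('r, 'x) ring_scheme \<Rightarrow> ('r, 'm, 'y) module_scheme \<Rightarrow> ('r, 'n, 'z) module_scheme \<Rightarrow>
     ('r, 't, 'w) module_scheme \<Rightarrow> ('m \<times> 'n \<Rightarrow> 't) \<Rightarrow> bool"
  where "tensor_product_wrt _ R M N T \<phi> \<longleftrightarrow>
    module R M \<and> module R N \<and> module R T \<and> bilinear_map R M N T \<phi> \<and>
    (\<forall>(S :: ('r, 's) module) \<psi>. module R S \<and> bilinear_map R M N S \<psi> \<longrightarrow>
       (\<exists>!f. f \<in> linear_maps R T S \<inter> extensional (carrier T) \<and>
             (\<forall>p \<in> carrier M \<times> carrier N. \<psi> p = f (\<phi> p))))"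

text \<open>
  HOL cannot quantify over the type \<open>'s\<close> inside a formula. It suffices to test one type that
  is large enough: any submodule of \<open>S\<close> generated by a bilinear image, and any homomorphic image
  of \<open>T\<close>, has an isomorphic copy with elements in the type used here. That this gives the
  universal property for modules over arbitrary types is \<open>is_tensor_product_universal\<close> below.
\<close>

definition is_tensor_product ::
    "('r, 'x) ring_scheme \<Rightarrow> ('r, 'm, 'y) module_scheme \<Rightarrow> ('r, 'n, 'z) module_scheme \<Rightarrow>
     ('r, 't, 'w) module_scheme \<Rightarrow> ('m \<times> 'n \<Rightarrow> 't) \<Rightarrow> bool"
  where "is_tensor_product R M N T \<phi> \<longleftrightarrow>
    tensor_product_wrt TYPE((('m \<times> 'n) list + 't) set) R M N T \<phi>"

definition generates ::
    "('r, 'x) ring_scheme \<Rightarrow> ('r, 'n, 'y) module_scheme \<Rightarrow> 'n set \<Rightarrow> bool"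
  where "generates R N G \<longleftrightarrow> G \<subseteq> carrier N \<and> (\<lambda>H. submodule H R N) hull G = carrier N"


subsection \<open>Independence of the universal property from the type tested\<close>

definition transport :: "('s \<Rightarrow> 'u) \<Rightarrow> 's set \<Rightarrow> ('r, 's, 'x) module_scheme \<Rightarrow> ('r, 'u) module"
  where "transport g H S =
    \<lparr>carrier = g ` H, mult = undefined, one = undefined, zero = g \<zero>\<^bsub>S\<^esub>,
     add = (\<lambda>x y. g (inv_into H g x \<oplus>\<^bsub>S\<^esub> inv_into H g y)),
     smult = (\<lambda>r x. g (r \<odot>\<^bsub>S\<^esub> inv_into H g x))\<rparr>"

lemma transport_simps:
  assumes "inj_on g H"
  shows "carrier (transport g H S) = g ` H"
    and "\<zero>\<^bsub>transport g H S\<^esub> = g \<zero>\<^bsub>S\<^esub>"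
    and "x \<in> H \<Longrightarrow> y \<in> H \<Longrightarrow> g x \<oplus>\<^bsub>transport g H S\<^esub> g y = g (x \<oplus>\<^bsub>S\<^esub> y)"
    and "x \<in> H \<Longrightarrow> r \<odot>\<^bsub>transport g H S\<^esub> g x = g (r \<odot>\<^bsub>S\<^esub> x)"
  using assms by (auto simp: transport_def)

lemma module_transport:
  assumes S: "module R S" and H: "H \<subseteq> carrier S" "\<zero>\<^bsub>S\<^esub> \<in> H"
    and add: "\<And>x y. x \<in> H \<Longrightarrow> y \<in> H \<Longrightarrow> x \<oplus>\<^bsub>S\<^esub> y \<in> H"
    and smult: "\<And>r x. r \<in> carrier R \<Longrightarrow> x \<in> H \<Longrightarrow> r \<odot>\<^bsub>S\<^esub> x \<in> H"
    and inj: "inj_on g H"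
  shows "module R (transport g H S)"
proof -
  interpret S: module R S by (rule S)
  note [simp] = transport_simps[OF inj]
  have c: "\<And>x. x \<in> H \<Longrightarrow> x \<in> carrier S" using H by auto
  have neg: "\<ominus>\<^bsub>S\<^esub> x \<in> H" "\<ominus>\<^bsub>S\<^esub> x \<oplus>\<^bsub>S\<^esub> x = \<zero>\<^bsub>S\<^esub>" if "x \<in> H" for x
  proof -
    have "(\<ominus>\<^bsub>R\<^esub> \<one>\<^bsub>R\<^esub>) \<odot>\<^bsub>S\<^esub> x = \<ominus>\<^bsub>S\<^esub> x"
      using that c by (simp add: S.smult_l_minus)
    then show "\<ominus>\<^bsub>S\<^esub> x \<in> H" using smult[of "\<ominus>\<^bsub>R\<^esub> \<one>\<^bsub>R\<^esub>" x] that by simp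
    show "\<ominus>\<^bsub>S\<^esub> x \<oplus>\<^bsub>S\<^esub> x = \<zero>\<^bsub>S\<^esub>" using that c by (simp add: S.M.l_neg)
  qed
  have "abelian_group (transport g H S)"
  proof (rule abelian_groupI)
    fix x assume "x \<in> carrier (transport g H S)"
    then obtain u where u: "x = g u" "u \<in> H" by auto
    show "\<exists>y\<in>carrier (transport g H S). y \<oplus>\<^bsub>transport g H S\<^esub> x = \<zero>\<^bsub>transport g H S\<^esub>"
      using neg[of u] u by (intro bexI[of _ "g (\<ominus>\<^bsub>S\<^esub> u)"]) auto
  qed (use H add c in \<open>auto simp: S.M.a_ac\<close>)
  moreover have "cring R" by (rule S.is_cring)
  ultimately show ?thesis
    by (intro moduleI)
       (use smult add c in \<open>auto simp: S.smult_l_distr S.smult_r_distr S.smult_assoc1\<close>)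
qed

text \<open>Every element of the submodule generated by a bilinear image is the value of such a sum.\<close>

definition list_sum :: "('r, 's, 'x) module_scheme \<Rightarrow> ('p \<Rightarrow> 's) \<Rightarrow> 'p list \<Rightarrow> 's"
  where "list_sum S \<psi> ps = foldr (\<lambda>p s. \<psi> p \<oplus>\<^bsub>S\<^esub> s) ps \<zero>\<^bsub>S\<^esub>"

theorem is_tensor_product_universal:
  fixes R :: "('r, 'x) ring_scheme" and M :: "('r, 'm, 'y) module_scheme"
    and N :: "('r, 'n, 'z) module_scheme" and T :: "('r, 't, 'w) module_scheme"
  assumes "is_tensor_product R M N T \<phi>"
  shows "tensor_product_wrt TYPE('s) R M N T \<phi>"
proof -
  have M: "module R M" and N: "module R N" and T: "module R T" and bil: "bilinear_map R M N T \<phi>"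
    and univ: "\<And>(S :: ('r, (('m \<times> 'n) list + 't) set) module) \<psi>.
      module R S \<Longrightarrow> bilinear_map R M N S \<psi> \<Longrightarrow>
       (\<exists>!f. f \<in> linear_maps R T S \<inter> extensional (carrier T) \<and>
             (\<forall>p \<in> carrier M \<times> carrier N. \<psi> p = f (\<phi> p)))"
    using assms unfolding is_tensor_product_def tensor_product_wrt_def by blast+
  interpret M: module R M by (rule M)
  interpret T: module R T by (rule T)
  have \<phi>: "\<And>p. p \<in> carrier M \<times> carrier N \<Longrightarrow> \<phi> p \<in> carrier T"
    using bil unfolding bilinear_map_def by blast
  have main: "\<exists>!f. f \<in> linear_maps R T S \<inter> extensional (carrier T) \<and>
             (\<forall>p \<in> carrier M \<times> carrier N. \<psi> p = f (\<phi> p))"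
    if S: "module R S" and \<psi>bil: "bilinear_map R M N S \<psi>" for S :: "('r, 's) module" and \<psi>
  proof -
    interpret S: module R S by (rule S)
    have \<psi>: "\<And>p. p \<in> carrier M \<times> carrier N \<Longrightarrow> \<psi> p \<in> carrier S"
      using \<psi>bil unfolding bilinear_map_def by blast
    let ?P = "lists (carrier M \<times> carrier N)"
    let ?ev = "list_sum S \<psi>"
    have ev_c: "?ev l \<in> carrier S" if "l \<in> ?P" for l
      using that by (induction l) (auto simp: list_sum_def intro!: \<psi>)
    have ev_app: "?ev (l @ l') = ?ev l \<oplus>\<^bsub>S\<^esub> ?ev l'" if "l \<in> ?P" "l' \<in> ?P" for l l'
      using that(1)
    proof (induction l)
      case Nil
      then show ?case using ev_c[OF that(2)] by (simp add: list_sum_def)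
    next
      case (Cons p l)
      then show ?case using ev_c[of l] ev_c[OF that(2)] \<psi>[of p]
        by (simp add: list_sum_def S.M.a_assoc)
    qed
    have ev_smult: "?ev (map (\<lambda>(m, n). (r \<odot>\<^bsub>M\<^esub> m, n)) l) = r \<odot>\<^bsub>S\<^esub> ?ev l"
      if "l \<in> ?P" "r \<in> carrier R" for l r
      using that(1)
    proof (induction l)
      case Nil
      then show ?case using that(2) by (simp add: list_sum_def)
    next
      case (Cons p l)
      obtain m n where p: "p = (m, n)" by force
      have "\<psi> (r \<odot>\<^bsub>M\<^esub> m, n) = r \<odot>\<^bsub>S\<^esub> \<psi> (m, n)"
        using \<psi>bil that(2) Cons.hyps p unfolding bilinear_map_def by simp
      then show ?case using Cons ev_c[of l] \<psi>[of p] that(2) p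
        by (simp add: list_sum_def S.smult_r_distr)
    qed
    define H where "H = ?ev ` ?P"
    define g :: "'s \<Rightarrow> (('m \<times> 'n) list + 't) set" where "g = (\<lambda>s. Inl ` {l \<in> ?P. ?ev l = s})"
    have inj: "inj_on g H"
    proof (rule inj_onI)
      fix s s' assume "s \<in> H" "s' \<in> H" "g s = g s'"
      then obtain l where "l \<in> ?P" "?ev l = s" by (auto simp: H_def)
      then have "Inl l \<in> g s" by (auto simp: g_def)
      then have "Inl l \<in> g s'" using \<open>g s = g s'\<close> by simp
      then show "s = s'" using \<open>?ev l = s\<close> by (auto simp: g_def)
    qed
    have Hc: "H \<subseteq> carrier S" using ev_c by (auto simp: H_def)
    have H0: "\<zero>\<^bsub>S\<^esub> \<in> H" unfolding H_def by (rule image_eqI[of _ _ "[]"]) (auto simp: list_sum_def)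
    have Ha: "x \<oplus>\<^bsub>S\<^esub> y \<in> H" if xy: "x \<in> H" "y \<in> H" for x y
    proof -
      obtain l l' where l: "l \<in> ?P" "l' \<in> ?P" "x = ?ev l" "y = ?ev l'" using xy unfolding H_def by blast
      then have "x \<oplus>\<^bsub>S\<^esub> y = ?ev (l @ l')" by (simp only: ev_app)
      moreover have "l @ l' \<in> ?P" using l by simp
      ultimately show ?thesis unfolding H_def by blast
    qed
    have Hs: "r \<odot>\<^bsub>S\<^esub> x \<in> H" if rx: "r \<in> carrier R" "x \<in> H" for r x
    proof -
      obtain l where l: "l \<in> ?P" "x = ?ev l" using rx unfolding H_def by blast
      then have "r \<odot>\<^bsub>S\<^esub> x = ?ev (map (\<lambda>(m, n). (r \<odot>\<^bsub>M\<^esub> m, n)) l)" by (simp only: ev_smult rx)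
      moreover have "map (\<lambda>(m, n). (r \<odot>\<^bsub>M\<^esub> m, n)) l \<in> ?P" using l rx by fastforce
      ultimately show ?thesis unfolding H_def by blast
    qed
    have \<psi>H: "\<psi> p \<in> H" if "p \<in> carrier M \<times> carrier N" for p
      unfolding H_def using that \<psi>[OF that] by (intro image_eqI[of _ _ "[p]"]) (auto simp: list_sum_def)
    let ?S' = "transport g H S"
    note tr = transport_simps[OF inj, where S = S]
    have S': "module R ?S'" by (rule module_transport[OF S Hc H0 Ha Hs inj])
    have "bilinear_map R M N ?S' (g \<circ> \<psi>)"
      using \<psi>bil \<psi>H unfolding bilinear_map_def by (auto simp: tr)
    from univ[OF S' this] obtain f where f: "f \<in> linear_maps R T ?S'"
      and f\<phi>: "\<And>p. p \<in> carrier M \<times> carrier N \<Longrightarrow> g (\<psi> p) = f (\<phi> p)" by auto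
    define f' where "f' = restrict (\<lambda>t. inv_into H g (f t)) (carrier T)"
    have fH: "f t \<in> g ` H" if "t \<in> carrier T" for t
      using f that by (auto simp: linear_maps_def tr)
    then have f'H: "f' t \<in> H" "g (f' t) = f t" if "t \<in> carrier T" for t
      using that unfolding f'_def by (auto simp: inv_into_into f_inv_into_f)
    have f'hom: "f' \<in> linear_maps R T S"
    proof -
      have "f' (x \<oplus>\<^bsub>T\<^esub> y) = f' x \<oplus>\<^bsub>S\<^esub> f' y" if "x \<in> carrier T" "y \<in> carrier T" for x y
      proof (rule inj_onD[OF inj])
        have "f (x \<oplus>\<^bsub>T\<^esub> y) = f x \<oplus>\<^bsub>?S'\<^esub> f y" using f that by (auto simp: linear_maps_def)
        then show "g (f' (x \<oplus>\<^bsub>T\<^esub> y)) = g (f' x \<oplus>\<^bsub>S\<^esub> f' y)"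
          using that f'H tr(3)[of "f' x" "f' y"] by simp
      qed (use that f'H Ha in auto)
      moreover have "f' (r \<odot>\<^bsub>T\<^esub> x) = r \<odot>\<^bsub>S\<^esub> f' x" if "r \<in> carrier R" "x \<in> carrier T" for r x
      proof (rule inj_onD[OF inj])
        have "f (r \<odot>\<^bsub>T\<^esub> x) = r \<odot>\<^bsub>?S'\<^esub> f x" using f that by (auto simp: linear_maps_def)
        then show "g (f' (r \<odot>\<^bsub>T\<^esub> x)) = g (r \<odot>\<^bsub>S\<^esub> f' x)"
          using that f'H tr(4)[of "f' x" r] by simp
      qed (use that f'H Hs in auto)
      ultimately show ?thesis using f'H Hc by (auto simp: linear_maps_def)
    qed
    have f'ext: "f' \<in> extensional (carrier T)" by (simp add: f'_def)
    have f'\<phi>: "\<psi> p = f' (\<phi> p)" if "p \<in> carrier M \<times> carrier N" for p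
      using inj_onD[OF inj, of "\<psi> p" "f' (\<phi> p)"] f\<phi>[OF that] f'H[OF \<phi>[OF that]] \<psi>H[OF that] by simp
    have uniq: "f1 = f2"
      if h1: "f1 \<in> linear_maps R T S" "f1 \<in> extensional (carrier T)"
          "\<And>p. p \<in> carrier M \<times> carrier N \<Longrightarrow> \<psi> p = f1 (\<phi> p)"
        and h2: "f2 \<in> linear_maps R T S" "f2 \<in> extensional (carrier T)"
          "\<And>p. p \<in> carrier M \<times> carrier N \<Longrightarrow> \<psi> p = f2 (\<phi> p)" for f1 f2
    proof -
      define h where "h = (\<lambda>t. f1 t \<ominus>\<^bsub>S\<^esub> f2 t)"
      have c: "f1 t \<in> carrier S" "f2 t \<in> carrier S" if "t \<in> carrier T" for t
        using h1(1) h2(1) that by (auto simp: linear_maps_def)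
      have hc: "h t \<in> carrier S" if "t \<in> carrier T" for t
        using c[OF that] by (simp add: h_def)
      have ha: "h (x \<oplus>\<^bsub>T\<^esub> y) = h x \<oplus>\<^bsub>S\<^esub> h y" if "x \<in> carrier T" "y \<in> carrier T" for x y
      proof -
        have "f1 (x \<oplus>\<^bsub>T\<^esub> y) = f1 x \<oplus>\<^bsub>S\<^esub> f1 y" "f2 (x \<oplus>\<^bsub>T\<^esub> y) = f2 x \<oplus>\<^bsub>S\<^esub> f2 y"
          using h1(1) h2(1) that by (auto simp: linear_maps_def)
        then show ?thesis using c[OF that(1)] c[OF that(2)]
          by (simp add: h_def a_minus_def S.M.minus_add S.M.a_ac)
      qed
      have hs: "h (r \<odot>\<^bsub>T\<^esub> x) = r \<odot>\<^bsub>S\<^esub> h x" if "r \<in> carrier R" "x \<in> carrier T" for r x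
      proof -
        have "f1 (r \<odot>\<^bsub>T\<^esub> x) = r \<odot>\<^bsub>S\<^esub> f1 x" "f2 (r \<odot>\<^bsub>T\<^esub> x) = r \<odot>\<^bsub>S\<^esub> f2 x"
          using h1(1) h2(1) that by (auto simp: linear_maps_def)
        then show ?thesis using c[OF that(2)] that(1)
          by (simp add: h_def a_minus_def S.smult_r_distr S.smult_r_minus)
      qed
      have h\<phi>: "h (\<phi> p) = \<zero>\<^bsub>S\<^esub>" if "p \<in> carrier M \<times> carrier N" for p
        using h1(3)[OF that, symmetric] h2(3)[OF that, symmetric] \<psi>[OF that]
        by (simp add: h_def a_minus_def S.M.r_neg)
      have h0: "h \<zero>\<^bsub>T\<^esub> = \<zero>\<^bsub>S\<^esub>"
        using hs[of "\<zero>\<^bsub>R\<^esub>" "\<zero>\<^bsub>T\<^esub>"] hc[of "\<zero>\<^bsub>T\<^esub>"] by simp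
      define K where "K = h ` carrier T"
      define k :: "'s \<Rightarrow> (('m \<times> 'n) list + 't) set" where "k = (\<lambda>s. Inr ` {t \<in> carrier T. h t = s})"
      have kinj: "inj_on k K"
      proof (rule inj_onI)
        fix s s' assume "s \<in> K" "s' \<in> K" "k s = k s'"
        then obtain t where "t \<in> carrier T" "h t = s" by (auto simp: K_def)
        then have "Inr t \<in> k s" by (auto simp: k_def)
        then have "Inr t \<in> k s'" using \<open>k s = k s'\<close> by simp
        then show "s = s'" using \<open>h t = s\<close> by (auto simp: k_def)
      qed
      have Kc: "K \<subseteq> carrier S" using hc by (auto simp: K_def)
      have K0: "\<zero>\<^bsub>S\<^esub> \<in> K" using h0 unfolding K_def by (metis T.M.zero_closed imageI)
      have Ka: "x \<oplus>\<^bsub>S\<^esub> y \<in> K" if "x \<in> K" "y \<in> K" for x y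
        using that ha unfolding K_def by (metis (no_types, lifting) T.M.a_closed image_iff)
      have Ks: "r \<odot>\<^bsub>S\<^esub> x \<in> K" if "r \<in> carrier R" "x \<in> K" for r x
        using that hs unfolding K_def by (metis (no_types, lifting) T.smult_closed image_iff)
      let ?K' = "transport k K S"
      note kr = transport_simps[OF kinj, where S = S]
      have K': "module R ?K'" by (rule module_transport[OF S Kc K0 Ka Ks kinj])
      have zero_bil: "bilinear_map R M N ?K' (\<lambda>p. k \<zero>\<^bsub>S\<^esub>)"
        using K0 unfolding bilinear_map_def by (auto simp: kr)
      have hK: "h t \<in> K" if "t \<in> carrier T" for t using that by (simp add: K_def)
      let ?u = "restrict (\<lambda>t. k (h t)) (carrier T)" and ?v = "restrict (\<lambda>t. k \<zero>\<^bsub>S\<^esub>) (carrier T)"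
      have "?u \<in> linear_maps R T ?K'" using hK ha hs by (auto simp: linear_maps_def kr)
      moreover have "?v \<in> linear_maps R T ?K'" using K0 by (auto simp: linear_maps_def kr)
      moreover have "\<forall>p \<in> carrier M \<times> carrier N. k \<zero>\<^bsub>S\<^esub> = ?u (\<phi> p)"
        using \<phi> h\<phi> by simp
      moreover have "\<forall>p \<in> carrier M \<times> carrier N. k \<zero>\<^bsub>S\<^esub> = ?v (\<phi> p)"
        using \<phi> by simp
      ultimately have "?u = ?v" using univ[OF K' zero_bil] by (metis IntI restrict_extensional)
      have "h t = \<zero>\<^bsub>S\<^esub>" if "t \<in> carrier T" for t
        using fun_cong[OF \<open>?u = ?v\<close>, of t] that K0 hK[OF that] inj_onD[OF kinj] by simp
      then have "f1 t = f2 t" if "t \<in> carrier T" for t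
        using that c[OF that] S.M.minus_equality[of "f1 t" "\<ominus>\<^bsub>S\<^esub> f2 t"]
      unfolding h_def a_minus_def by simp
      then show ?thesis using h1(2) h2(2) by (rule extensionalityI[rotated 2])
    qed
    show ?thesis
    proof (rule ex1I[of _ f'])
      show "f' \<in> linear_maps R T S \<inter> extensional (carrier T) \<and>
        (\<forall>p\<in>carrier M \<times> carrier N. \<psi> p = f' (\<phi> p))"
        using f'hom f'ext f'\<phi> by blast
    next
      fix f2 assume a: "f2 \<in> linear_maps R T S \<inter> extensional (carrier T) \<and>
        (\<forall>p\<in>carrier M \<times> carrier N. \<psi> p = f2 (\<phi> p))"
      show "f2 = f'"
        by (rule uniq[OF _ _ _ f'hom f'ext f'\<phi>]) (use a in blast)+
    qed
  qed
  then show ?thesis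
    unfolding tensor_product_wrt_def using M N T bil by blast
qed

end

theory Submission
  imports Defs "HOL-Algebra.AbelCoset"
begin

text \<open>
  Let \<open>K\<close> be the module of all functions \<open>i \<mapsto> \<Sum>\<^sub>j a\<^sub>i\<^sub>j m'\<^sub>j\<close> from the index set to \<open>M\<close> in which every
  column \<open>a\<^sub>\<cdot>\<^sub>j\<close> is a finitely supported relation among the generators \<open>n\<^sub>i\<close>. Writing
  \<open>y = \<Sum>\<^sub>i c\<^sub>i n\<^sub>i\<close>, the class of \<open>i \<mapsto> c\<^sub>i x\<close> modulo \<open>K\<close> does not depend on the choice of \<open>c\<close>, so it is a
  bilinear map \<open>\<psi>(x, y)\<close>. The induced homomorphism on \<open>T\<close> sends \<open>\<Sum>\<^sub>i \<phi>(m\<^sub>i, n\<^sub>i)\<close> to the class of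
  \<open>(m\<^sub>i)\<^sub>i\<close>; if the sum vanishes, then \<open>(m\<^sub>i)\<^sub>i \<in> K\<close>. The converse is an exchange of
  summations.
\<close>

section \<open>Powers of a module\<close>

text \<open>Functions are total on the index type, with no condition on their support, so each
  module law reduces to the same law in \<open>M\<close> at every index. Families over a subset
  enter as functions extended by zero.\<close>

definition pointwise_module :: "('r, 'm, 'y) module_scheme \<Rightarrow> ('r, 'i \<Rightarrow> 'm) module"
  where "pointwise_module M =
    \<lparr>carrier = {v. \<forall>i. v i \<in> carrier M}, mult = undefined, one = undefined,
     zero = (\<lambda>_. \<zero>\<^bsub>M\<^esub>), add = (\<lambda>u v i. u i \<oplus>\<^bsub>M\<^esub> v i), smult = (\<lambda>r v i. r \<odot>\<^bsub>M\<^esub> v i)\<rparr>"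

lemma pointwise_module_simps [simp]:
  "carrier (pointwise_module M) = {v. \<forall>i. v i \<in> carrier M}"
  "\<zero>\<^bsub>pointwise_module M\<^esub> = (\<lambda>_. \<zero>\<^bsub>M\<^esub>)"
  "u \<oplus>\<^bsub>pointwise_module M\<^esub> v = (\<lambda>i. u i \<oplus>\<^bsub>M\<^esub> v i)"
  "r \<odot>\<^bsub>pointwise_module M\<^esub> v = (\<lambda>i. r \<odot>\<^bsub>M\<^esub> v i)"
  by (simp_all add: pointwise_module_def)

lemma module_pointwise_module:
  fixes R :: "('r, 'x) ring_scheme" and M :: "('r, 'm, 'y) module_scheme"
  assumes "module R M"
  shows "module R (pointwise_module M :: ('r, 'i \<Rightarrow> 'm) module)"
    (is "module R ?P")
proof -
  interpret module R M by (rule assms)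
  have "abelian_group ?P"
  proof (rule abelian_groupI)
    fix v assume "v \<in> carrier ?P"
    then show "\<exists>u\<in>carrier ?P. u \<oplus>\<^bsub>?P\<^esub> v = \<zero>\<^bsub>?P\<^esub>"
      by (intro bexI[of _ "\<lambda>i. \<ominus>\<^bsub>M\<^esub> v i"]) (auto simp: M.l_neg)
  qed (auto simp: M.a_ac)
  then show ?thesis
    by (intro moduleI) (auto simp: is_cring smult_l_distr smult_r_distr smult_assoc1)
qed

section \<open>Quotient of a module by a submodule\<close>

text \<open>The elementwise multiple of a coset by \<open>r\<close> can be too small to be a coset
  (for \<open>r\<close> zero it is a single element), so the coset of each multiple is formed
  instead. When \<open>K\<close> is a submodule these cosets all agree, and the union is their
  common value.\<close>

definition quotient_module ::
    "('r, 'm, 'y) module_scheme \<Rightarrow> 'm set \<Rightarrow> ('r, 'm set) module"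
  where "quotient_module M K =
    \<lparr>carrier = a_rcosets\<^bsub>M\<^esub> K, mult = undefined, one = undefined, zero = K,
     add = (\<lambda>X Y. X <+>\<^bsub>M\<^esub> Y), smult = (\<lambda>r X. \<Union>x\<in>X. K +>\<^bsub>M\<^esub> r \<odot>\<^bsub>M\<^esub> x)\<rparr>"

context
  fixes R :: "('r, 'x) ring_scheme" and M :: "('r, 'm, 'y) module_scheme" and K :: "'m set"
  assumes M: "module R M" and K: "submodule K R M"
begin

interpretation M: module R M by (rule M)
interpretation K: abelian_subgroup K M
  using K by (intro abelian_subgroupI3 additive_subgroupI)
    (auto simp: submodule_def intro: M.M.abelian_group_axioms)

lemma coset_eq_iff:
  assumes "x \<in> carrier M" "y \<in> carrier M"
  shows "K +>\<^bsub>M\<^esub> x = K +>\<^bsub>M\<^esub> y \<longleftrightarrow> x \<ominus>\<^bsub>M\<^esub> y \<in> K"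
  using assms K.a_repr_independence' K.a_repr_independenceD K.a_rcos_module
  unfolding a_minus_def by metis

lemma quotient_module_simps:
  shows carrier_quotient_module: "carrier (quotient_module M K) = (\<lambda>x. K +>\<^bsub>M\<^esub> x) ` carrier M"
    and zero_quotient_module: "\<zero>\<^bsub>quotient_module M K\<^esub> = K +>\<^bsub>M\<^esub> \<zero>\<^bsub>M\<^esub>"
    and add_quotient_module: "\<lbrakk>x \<in> carrier M; y \<in> carrier M\<rbrakk> \<Longrightarrow>
      (K +>\<^bsub>M\<^esub> x) \<oplus>\<^bsub>quotient_module M K\<^esub> (K +>\<^bsub>M\<^esub> y) = K +>\<^bsub>M\<^esub> (x \<oplus>\<^bsub>M\<^esub> y)"
    and smult_quotient_module: "\<lbrakk>r \<in> carrier R; x \<in> carrier M\<rbrakk> \<Longrightarrow>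
      r \<odot>\<^bsub>quotient_module M K\<^esub> (K +>\<^bsub>M\<^esub> x) = K +>\<^bsub>M\<^esub> (r \<odot>\<^bsub>M\<^esub> x)"
proof -
  show "carrier (quotient_module M K) = (\<lambda>x. K +>\<^bsub>M\<^esub> x) ` carrier M"
    by (auto simp: quotient_module_def A_RCOSETS_def')
  show "\<zero>\<^bsub>quotient_module M K\<^esub> = K +>\<^bsub>M\<^esub> \<zero>\<^bsub>M\<^esub>"
    by (simp add: quotient_module_def K.a_subset)
  show "(K +>\<^bsub>M\<^esub> x) \<oplus>\<^bsub>quotient_module M K\<^esub> (K +>\<^bsub>M\<^esub> y) = K +>\<^bsub>M\<^esub> (x \<oplus>\<^bsub>M\<^esub> y)"
    if "x \<in> carrier M" "y \<in> carrier M"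
    using that by (simp add: quotient_module_def K.a_rcos_sum)
  show "r \<odot>\<^bsub>quotient_module M K\<^esub> (K +>\<^bsub>M\<^esub> x) = K +>\<^bsub>M\<^esub> (r \<odot>\<^bsub>M\<^esub> x)"
    if r: "r \<in> carrier R" and x: "x \<in> carrier M"
  proof -
    \<comment> \<open>Independence of the representative: \<open>y - x\<close> lies in
      \<open>K\<close>, hence so does \<open>r (y - x)\<close>, which is the difference of
      \<open>r y\<close> and \<open>r x\<close>.\<close>
    have coset: "K +>\<^bsub>M\<^esub> (r \<odot>\<^bsub>M\<^esub> y) = K +>\<^bsub>M\<^esub> (r \<odot>\<^bsub>M\<^esub> x)" if y: "y \<in> K +>\<^bsub>M\<^esub> x" for y
    proof -
      have yc: "y \<in> carrier M" using y x by (rule K.a_elemrcos_carrier[rotated])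
      then have "y \<ominus>\<^bsub>M\<^esub> x \<in> K" using K.a_rcos_module_imp[OF x y] by (simp add: a_minus_def)
      then have "r \<odot>\<^bsub>M\<^esub> (y \<ominus>\<^bsub>M\<^esub> x) \<in> K" using r K by (simp add: submodule.smult_closed)
      then show ?thesis
        using r x yc by (simp add: coset_eq_iff a_minus_def M.smult_r_distr M.smult_r_minus)
    qed
    \<comment> \<open>A union of equal sets is that set only over a nonempty index set;
      \<open>x\<close> is a member of its own coset.\<close>
    have "x \<in> K +>\<^bsub>M\<^esub> x" using x by (rule K.a_rcos_self)
    then have "K +>\<^bsub>M\<^esub> x \<noteq> {}" by blast
    have "r \<odot>\<^bsub>quotient_module M K\<^esub> (K +>\<^bsub>M\<^esub> x) = (\<Union>y\<in>K +>\<^bsub>M\<^esub> x. K +>\<^bsub>M\<^esub> (r \<odot>\<^bsub>M\<^esub> y))"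
      by (simp add: quotient_module_def)
    also have "\<dots> = (\<Union>y\<in>K +>\<^bsub>M\<^esub> x. K +>\<^bsub>M\<^esub> (r \<odot>\<^bsub>M\<^esub> x))"
      by (rule SUP_cong[OF refl coset])
    also have "\<dots> = K +>\<^bsub>M\<^esub> (r \<odot>\<^bsub>M\<^esub> x)" using \<open>K +>\<^bsub>M\<^esub> x \<noteq> {}\<close> by (rule SUP_const)
    finally show ?thesis .
  qed
qed

lemma module_quotient_module: "module R (quotient_module M K)"
proof -
  note [simp] = quotient_module_simps
  have "abelian_group (quotient_module M K)"
  proof (rule abelian_groupI)
    fix X assume "X \<in> carrier (quotient_module M K)"
    then obtain x where "X = K +>\<^bsub>M\<^esub> x" "x \<in> carrier M" by auto
    then show "\<exists>Y\<in>carrier (quotient_module M K). Y \<oplus>\<^bsub>quotient_module M K\<^esub> X = \<zero>\<^bsub>quotient_module M K\<^esub>"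
      by (intro bexI[of _ "K +>\<^bsub>M\<^esub> (\<ominus>\<^bsub>M\<^esub> x)"]) (auto simp: M.M.l_neg)
  qed (auto simp: M.M.a_ac)
  then show ?thesis
    by (intro moduleI)
      (auto simp: M.is_cring M.smult_l_distr M.smult_r_distr M.smult_assoc1)
qed

end

section \<open>Finitely supported coefficients and linear combinations\<close>

text \<open>The free module on \<open>I\<close>, its elements encoded as total functions that vanish
  off \<open>I\<close>, so that the support lies in \<open>I\<close> automatically.\<close>

definition fin_coeffs :: "('r, 'x) ring_scheme \<Rightarrow> 'i set \<Rightarrow> ('i \<Rightarrow> 'r) set"
  where "fin_coeffs R I =
    {c. (\<forall>i. c i \<in> carrier R) \<and> finite {i. c i \<noteq> \<zero>\<^bsub>R\<^esub>} \<and> (\<forall>i. i \<notin> I \<longrightarrow> c i = \<zero>\<^bsub>R\<^esub>)}"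

lemma fin_coeffsD:
  assumes "c \<in> fin_coeffs R I"
  shows "c i \<in> carrier R" "finite {i. c i \<noteq> \<zero>\<^bsub>R\<^esub>}" "{i. c i \<noteq> \<zero>\<^bsub>R\<^esub>} \<subseteq> I"
  using assms unfolding fin_coeffs_def by blast+

text \<open>The sum runs over the support because \<open>I\<close> may be infinite and a
  \<open>finsum\<close> over an infinite set is zero by convention.\<close>

definition lin_comb ::
    "('r, 'x) ring_scheme \<Rightarrow> ('r, 'n, 'z) module_scheme \<Rightarrow> ('i \<Rightarrow> 'n) \<Rightarrow> ('i \<Rightarrow> 'r) \<Rightarrow> 'n"
  where "lin_comb R N n c = (\<Oplus>\<^bsub>N\<^esub>i\<in>{i. c i \<noteq> \<zero>\<^bsub>R\<^esub>}. c i \<odot>\<^bsub>N\<^esub> n i)"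

context
  fixes R :: "('r, 'x) ring_scheme" and N :: "('r, 'n, 'z) module_scheme"
    and I :: "'i set" and n :: "'i \<Rightarrow> 'n"
  assumes N: "module R N" and n: "n \<in> I \<rightarrow> carrier N"
begin

interpretation N: module R N by (rule N)

text \<open>Coefficient functions with different supports can be compared once their combinations
  are sums over one common finite set; the extra terms have coefficient zero and vanish.\<close>

lemma lin_comb_superset:
  assumes "finite B" "B \<subseteq> I" "{i. c i \<noteq> \<zero>\<^bsub>R\<^esub>} \<subseteq> B" "\<And>i. c i \<in> carrier R"
  shows "lin_comb R N n c = (\<Oplus>\<^bsub>N\<^esub>i\<in>B. c i \<odot>\<^bsub>N\<^esub> n i)"
  unfolding lin_comb_def
proof (rule N.M.add.finprod_mono_neutral_cong_left)
  have nc: "\<And>i. i \<in> B \<Longrightarrow> n i \<in> carrier N" using n assms(2) by auto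
  show "(\<lambda>i. c i \<odot>\<^bsub>N\<^esub> n i) \<in> B \<rightarrow> carrier N" using nc assms(4) by auto
  show "c i \<odot>\<^bsub>N\<^esub> n i = \<zero>\<^bsub>N\<^esub>" if "i \<in> B - {i. c i \<noteq> \<zero>\<^bsub>R\<^esub>}" for i
    using that nc[of i] by simp
qed (use assms in auto)

lemma lin_comb_closed: "c \<in> fin_coeffs R I \<Longrightarrow> lin_comb R N n c \<in> carrier N"
  using n unfolding lin_comb_def fin_coeffs_def by (intro N.M.finsum_closed) blast

lemma fin_coeffs_add:
  assumes "c \<in> fin_coeffs R I" "d \<in> fin_coeffs R I"
  shows "(\<lambda>i. c i \<oplus>\<^bsub>R\<^esub> d i) \<in> fin_coeffs R I"
proof -
  have "{i. c i \<oplus>\<^bsub>R\<^esub> d i \<noteq> \<zero>\<^bsub>R\<^esub>} \<subseteq> {i. c i \<noteq> \<zero>\<^bsub>R\<^esub>} \<union> {i. d i \<noteq> \<zero>\<^bsub>R\<^esub>}" by auto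
  then have "finite {i. c i \<oplus>\<^bsub>R\<^esub> d i \<noteq> \<zero>\<^bsub>R\<^esub>}"
    by (rule finite_subset) (use assms in \<open>simp add: fin_coeffs_def\<close>)
  then show ?thesis using assms by (simp add: fin_coeffs_def)
qed

lemma fin_coeffs_smult:
  assumes "c \<in> fin_coeffs R I" "r \<in> carrier R"
  shows "(\<lambda>i. r \<otimes>\<^bsub>R\<^esub> c i) \<in> fin_coeffs R I"
proof -
  have "{i. r \<otimes>\<^bsub>R\<^esub> c i \<noteq> \<zero>\<^bsub>R\<^esub>} \<subseteq> {i. c i \<noteq> \<zero>\<^bsub>R\<^esub>}" using assms(2) by auto
  then have "finite {i. r \<otimes>\<^bsub>R\<^esub> c i \<noteq> \<zero>\<^bsub>R\<^esub>}"
    by (rule finite_subset) (use assms in \<open>simp add: fin_coeffs_def\<close>)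
  then show ?thesis using assms by (simp add: fin_coeffs_def)
qed

lemma lin_comb_add:
  assumes c: "c \<in> fin_coeffs R I" and d: "d \<in> fin_coeffs R I"
  shows "lin_comb R N n (\<lambda>i. c i \<oplus>\<^bsub>R\<^esub> d i) = lin_comb R N n c \<oplus>\<^bsub>N\<^esub> lin_comb R N n d"
proof -
  \<comment> \<open>Cancellation may shrink the support of the sum, so all three combinations are
    expanded over the union of the two supports.\<close>
  let ?B = "{i. c i \<noteq> \<zero>\<^bsub>R\<^esub>} \<union> {i. d i \<noteq> \<zero>\<^bsub>R\<^esub>}"
  have B: "finite ?B" "?B \<subseteq> I" and cR: "\<And>i. c i \<in> carrier R" and dR: "\<And>i. d i \<in> carrier R"
    using fin_coeffsD[OF c] fin_coeffsD[OF d] by simp_all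
  have nB: "\<And>i. i \<in> ?B \<Longrightarrow> n i \<in> carrier N" using B(2) n by blast
  have "lin_comb R N n (\<lambda>i. c i \<oplus>\<^bsub>R\<^esub> d i) = (\<Oplus>\<^bsub>N\<^esub>i\<in>?B. (c i \<oplus>\<^bsub>R\<^esub> d i) \<odot>\<^bsub>N\<^esub> n i)"
    using cR dR by (intro lin_comb_superset B) auto
  also have "\<dots> = (\<Oplus>\<^bsub>N\<^esub>i\<in>?B. c i \<odot>\<^bsub>N\<^esub> n i \<oplus>\<^bsub>N\<^esub> d i \<odot>\<^bsub>N\<^esub> n i)"
    using cR dR nB by (intro N.M.finsum_cong') (auto simp: N.smult_l_distr)
  also have "\<dots> = (\<Oplus>\<^bsub>N\<^esub>i\<in>?B. c i \<odot>\<^bsub>N\<^esub> n i) \<oplus>\<^bsub>N\<^esub> (\<Oplus>\<^bsub>N\<^esub>i\<in>?B. d i \<odot>\<^bsub>N\<^esub> n i)"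
    using cR dR nB by (intro N.M.finsum_addf) auto
  also have "(\<Oplus>\<^bsub>N\<^esub>i\<in>?B. c i \<odot>\<^bsub>N\<^esub> n i) = lin_comb R N n c"
    using cR by (intro lin_comb_superset[symmetric] B) auto
  also have "(\<Oplus>\<^bsub>N\<^esub>i\<in>?B. d i \<odot>\<^bsub>N\<^esub> n i) = lin_comb R N n d"
    using dR by (intro lin_comb_superset[symmetric] B) auto
  finally show ?thesis .
qed

lemma lin_comb_smult:
  assumes c: "c \<in> fin_coeffs R I" and r: "r \<in> carrier R"
  shows "lin_comb R N n (\<lambda>i. r \<otimes>\<^bsub>R\<^esub> c i) = r \<odot>\<^bsub>N\<^esub> lin_comb R N n c"
proof -
  let ?B = "{i. c i \<noteq> \<zero>\<^bsub>R\<^esub>}"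
  have B: "finite ?B" "?B \<subseteq> I" and cR: "\<And>i. c i \<in> carrier R"
    using fin_coeffsD[OF c] by simp_all
  have nB: "\<And>i. i \<in> ?B \<Longrightarrow> n i \<in> carrier N" using B(2) n by blast
  have "lin_comb R N n (\<lambda>i. r \<otimes>\<^bsub>R\<^esub> c i) = (\<Oplus>\<^bsub>N\<^esub>i\<in>?B. (r \<otimes>\<^bsub>R\<^esub> c i) \<odot>\<^bsub>N\<^esub> n i)"
    using cR r by (intro lin_comb_superset B) auto
  also have "\<dots> = (\<Oplus>\<^bsub>N\<^esub>i\<in>?B. r \<odot>\<^bsub>N\<^esub> (c i \<odot>\<^bsub>N\<^esub> n i))"
    using cR r nB by (intro N.M.finsum_cong') (auto simp: N.smult_assoc1)
  also have "\<dots> = r \<odot>\<^bsub>N\<^esub> (\<Oplus>\<^bsub>N\<^esub>i\<in>?B. c i \<odot>\<^bsub>N\<^esub> n i)"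
    using cR r nB B by (intro N.finsum_smult_ldistr[symmetric]) auto
  finally show ?thesis by (simp add: lin_comb_def)
qed

text \<open>The support of \<open>e\<close> is \<open>{i}\<close> except over the zero ring, where
  it is empty; expanding over the superset \<open>{i}\<close> treats both cases at once.\<close>

lemma lin_comb_unit:
  assumes "i \<in> I"
  defines "e \<equiv> \<lambda>l. if l = i then \<one>\<^bsub>R\<^esub> else \<zero>\<^bsub>R\<^esub>"
  shows "e \<in> fin_coeffs R I" "lin_comb R N n e = n i"
proof -
  have "n i \<in> carrier N" using assms(1) n by auto
  moreover have "lin_comb R N n e = (\<Oplus>\<^bsub>N\<^esub>l\<in>{i}. e l \<odot>\<^bsub>N\<^esub> n l)"
    using assms by (intro lin_comb_superset) (auto split: if_splits)
  ultimately show "lin_comb R N n e = n i" by (simp add: e_def)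
  have "finite {l. e l \<noteq> \<zero>\<^bsub>R\<^esub>}" by (rule finite_subset[of _ "{i}"]) (auto simp: e_def)
  then show "e \<in> fin_coeffs R I" using assms(1) by (auto simp: fin_coeffs_def e_def)
qed

lemma submodule_lin_combs: "submodule (lin_comb R N n ` fin_coeffs R I) R N"
proof -
  let ?L = "lin_comb R N n ` fin_coeffs R I"
  have sm: "r \<odot>\<^bsub>N\<^esub> x \<in> ?L" if "r \<in> carrier R" "x \<in> ?L" for r x
    using that by (auto simp: fin_coeffs_smult simp flip: lin_comb_smult)
  show ?thesis
  proof (rule N.submoduleI)
    have "(\<lambda>_. \<zero>\<^bsub>R\<^esub>) \<in> fin_coeffs R I" by (simp add: fin_coeffs_def)
    moreover have "lin_comb R N n (\<lambda>_. \<zero>\<^bsub>R\<^esub>) = \<zero>\<^bsub>N\<^esub>" by (simp add: lin_comb_def)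
    ultimately show "\<zero>\<^bsub>N\<^esub> \<in> ?L" by (metis imageI)
    show L: "?L \<subseteq> carrier N" using lin_comb_closed by auto
    show "\<ominus>\<^bsub>N\<^esub> x \<in> ?L" if "x \<in> ?L" for x
      \<comment> \<open>Negation is scaling by -1, so closure under scalars suffices.\<close>
      using sm[of "\<ominus>\<^bsub>R\<^esub> \<one>\<^bsub>R\<^esub>" x] that L by (auto simp: N.smult_l_minus)
    show "x \<oplus>\<^bsub>N\<^esub> y \<in> ?L" if "x \<in> ?L" "y \<in> ?L" for x y
      using that by (auto simp: fin_coeffs_add simp flip: lin_comb_add)
  qed (rule sm)
qed

text \<open>The hull is the smallest submodule containing the generators. The combinations form a
  submodule containing each \<open>n i\<close>, so the hull lies inside them.\<close>

lemma generates_imp_lin_comb: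
  assumes "generates R N (n ` I)" "y \<in> carrier N"
  obtains c where "c \<in> fin_coeffs R I" "lin_comb R N n c = y"
proof -
  have "n ` I \<subseteq> lin_comb R N n ` fin_coeffs R I"
  proof (rule image_subsetI)
    fix i assume "i \<in> I"
    show "n i \<in> lin_comb R N n ` fin_coeffs R I"
      by (rule image_eqI[where x = "\<lambda>l. if l = i then \<one>\<^bsub>R\<^esub> else \<zero>\<^bsub>R\<^esub>"])
        (simp_all only: lin_comb_unit[OF \<open>i \<in> I\<close>])
  qed
  then have "(\<lambda>H. submodule H R N) hull (n ` I) \<subseteq> lin_comb R N n ` fin_coeffs R I"
    by (rule hull_minimal) (rule submodule_lin_combs)
  then show thesis using assms that by (auto simp: generates_def)
qed

end

section \<open>The span of the syzygies with coefficients in \<open>M\<close>\<close>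

text \<open>One application of \<open>add\<close> contributes one column \<open>c\<close> with its
  element \<open>x\<close>, that is, one index \<open>j\<close> of the criterion. The inductive form
  keeps the number of columns out of the closure proofs.\<close>

inductive_set syzygy_span ::
    "('r, 'x) ring_scheme \<Rightarrow> ('r, 'm, 'y) module_scheme \<Rightarrow> ('r, 'n, 'z) module_scheme \<Rightarrow>
     'i set \<Rightarrow> ('i \<Rightarrow> 'n) \<Rightarrow> ('i \<Rightarrow> 'm) set"
  for R M N I n
  where
    zero: "(\<lambda>_. \<zero>\<^bsub>M\<^esub>) \<in> syzygy_span R M N I n"
  | add: "\<lbrakk>v \<in> syzygy_span R M N I n; x \<in> carrier M; c \<in> fin_coeffs R I; lin_comb R N n c = \<zero>\<^bsub>N\<^esub>\<rbrakk>
      \<Longrightarrow> (\<lambda>i. c i \<odot>\<^bsub>M\<^esub> x \<oplus>\<^bsub>M\<^esub> v i) \<in> syzygy_span R M N I n"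

text \<open>A scalar is absorbed into the element \<open>x\<close> of each column, by commutativity
  of the ring. A sum is built by adding the columns of one function to the other function, one at a
  time.\<close>

lemma submodule_syzygy_span:
  fixes R :: "('r, 'x) ring_scheme" and M :: "('r, 'm, 'y) module_scheme"
    and N :: "('r, 'n, 'z) module_scheme" and I :: "'i set"
  assumes M: "module R M"
  shows "submodule (syzygy_span R M N I n) R (pointwise_module M)"
proof -
  interpret M: module R M by (rule M)
  interpret P: module R "pointwise_module M :: ('r, 'i \<Rightarrow> 'm) module"
    by (rule module_pointwise_module[OF M])
  let ?K = "syzygy_span R M N I n" and ?P = "pointwise_module M :: ('r, 'i \<Rightarrow> 'm) module"
  have Kc: "v i \<in> carrier M" if "v \<in> ?K" for v i
    using that by induction (auto simp: fin_coeffs_def)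
  have sm: "(\<lambda>i. r \<odot>\<^bsub>M\<^esub> v i) \<in> ?K" if r: "r \<in> carrier R" and v: "v \<in> ?K" for r v
    using v
  proof induction
    case zero
    then show ?case using r by (simp add: syzygy_span.zero)
  next
    case (add v x c)
    have "c i \<in> carrier R" for i using add by (simp add: fin_coeffs_def)
    then have "(\<lambda>i. r \<odot>\<^bsub>M\<^esub> (c i \<odot>\<^bsub>M\<^esub> x \<oplus>\<^bsub>M\<^esub> v i)) = (\<lambda>i. c i \<odot>\<^bsub>M\<^esub> (r \<odot>\<^bsub>M\<^esub> x) \<oplus>\<^bsub>M\<^esub> r \<odot>\<^bsub>M\<^esub> v i)"
      using r add.hyps Kc[OF add.hyps(1)]
      by (simp add: M.smult_r_distr M.smult_assoc1[symmetric] M.m_comm)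
    then show ?case using add r by (simp add: syzygy_span.add)
  qed
  have ad: "(\<lambda>i. u i \<oplus>\<^bsub>M\<^esub> v i) \<in> ?K" if u: "u \<in> ?K" and v: "v \<in> ?K" for u v
    using u
  proof induction
    case zero
    then show ?case using v Kc[OF v] by simp
  next
    case (add u x c)
    have "c i \<in> carrier R" for i using add by (simp add: fin_coeffs_def)
    then have "(\<lambda>i. c i \<odot>\<^bsub>M\<^esub> x \<oplus>\<^bsub>M\<^esub> u i \<oplus>\<^bsub>M\<^esub> v i) = (\<lambda>i. c i \<odot>\<^bsub>M\<^esub> x \<oplus>\<^bsub>M\<^esub> (u i \<oplus>\<^bsub>M\<^esub> v i))"
      using add.hyps Kc[OF add.hyps(1)] Kc[OF v] by (simp add: M.M.a_assoc)
    then show ?case using add by (simp add: syzygy_span.add)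
  qed
  show ?thesis
  proof (rule P.submoduleI)
    show K: "?K \<subseteq> carrier ?P" using Kc by auto
    show "\<ominus>\<^bsub>?P\<^esub> v \<in> ?K" if "v \<in> ?K" for v
    proof -
      have "\<ominus>\<^bsub>?P\<^esub> v = (\<ominus>\<^bsub>R\<^esub> \<one>\<^bsub>R\<^esub>) \<odot>\<^bsub>?P\<^esub> v"
        using that K by (subst P.smult_l_minus) (auto simp del: pointwise_module_simps)
      then show ?thesis using sm[OF _ that, of "\<ominus>\<^bsub>R\<^esub> \<one>\<^bsub>R\<^esub>"] by simp
    qed
  qed (auto simp: sm ad syzygy_span.zero)
qed

text \<open>Each rule application in the derivation of \<open>v\<close> supplies one column, so
  induction lists the columns and their elements. The column index comes first in \<open>a\<close>,
  which makes every \<open>a j\<close> a member of \<open>fin_coeffs\<close>.\<close>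

lemma syzygy_spanE:
  assumes M: "module R M" and v: "v \<in> syzygy_span R M N I n"
  obtains k :: nat and m' a where
    "\<forall>j<k. m' j \<in> carrier M \<and> a j \<in> fin_coeffs R I \<and> lin_comb R N n (a j) = \<zero>\<^bsub>N\<^esub>"
    "\<forall>i. v i = (\<Oplus>\<^bsub>M\<^esub>j\<in>{..<k}. a j i \<odot>\<^bsub>M\<^esub> m' j)"
proof -
  interpret M: module R M by (rule M)
  have "\<exists>(k::nat) m' a. (\<forall>j<k. m' j \<in> carrier M \<and> a j \<in> fin_coeffs R I \<and> lin_comb R N n (a j) = \<zero>\<^bsub>N\<^esub>) \<and>
      (\<forall>i. v i = (\<Oplus>\<^bsub>M\<^esub>j\<in>{..<k}. a j i \<odot>\<^bsub>M\<^esub> m' j))"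
    using v
  proof induction
    case zero
    show ?case by (intro exI[of _ "0::nat"]) simp
  next
    case (add v x c)
    from add.IH obtain k :: nat and m' a where h:
      "\<forall>j<k. m' j \<in> carrier M \<and> a j \<in> fin_coeffs R I \<and> lin_comb R N n (a j) = \<zero>\<^bsub>N\<^esub>"
      and v: "\<forall>i. v i = (\<Oplus>\<^bsub>M\<^esub>j\<in>{..<k}. a j i \<odot>\<^bsub>M\<^esub> m' j)" by (elim exE conjE)
    have cR: "c i \<in> carrier R" for i using add.hyps(3) by (rule fin_coeffsD)
    have aR: "a j i \<in> carrier R" and mM: "m' j \<in> carrier M" if "j < k" for i j
      using h that fin_coeffsD(1)[of "a j" R I] by auto
    \<comment> \<open>The new column takes the index \<open>k\<close>; the updates leave all entries
      below \<open>k\<close> unchanged.\<close>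
    have "c i \<odot>\<^bsub>M\<^esub> x \<oplus>\<^bsub>M\<^esub> v i = (\<Oplus>\<^bsub>M\<^esub>j\<in>{..<Suc k}. (a(k := c)) j i \<odot>\<^bsub>M\<^esub> (m'(k := x)) j)" for i
    proof -
      have "(\<Oplus>\<^bsub>M\<^esub>j\<in>{..<k}. (a(k := c)) j i \<odot>\<^bsub>M\<^esub> (m'(k := x)) j) = v i"
        unfolding v[rule_format] using mM aR by (intro M.M.finsum_cong') auto
      moreover have "(\<Oplus>\<^bsub>M\<^esub>j\<in>{..<Suc k}. (a(k := c)) j i \<odot>\<^bsub>M\<^esub> (m'(k := x)) j) =
          c i \<odot>\<^bsub>M\<^esub> x \<oplus>\<^bsub>M\<^esub> (\<Oplus>\<^bsub>M\<^esub>j\<in>{..<k}. (a(k := c)) j i \<odot>\<^bsub>M\<^esub> (m'(k := x)) j)"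
        using mM aR cR add.hyps(2) unfolding lessThan_Suc by (subst M.M.finsum_insert) auto
      ultimately show ?thesis by (simp only:)
    qed
    moreover have "\<forall>j<Suc k. (m'(k := x)) j \<in> carrier M \<and> (a(k := c)) j \<in> fin_coeffs R I \<and>
        lin_comb R N n ((a(k := c)) j) = \<zero>\<^bsub>N\<^esub>"
      using h add.hyps(2-4) by (simp add: less_Suc_eq)
    ultimately show ?case by blast
  qed
  then show thesis using that by blast
qed

section \<open>Linear and bilinear maps on finite sums\<close>

lemma linear_maps_zero:
  assumes "module R T" "module R S" "f \<in> linear_maps R T S"
  shows "f \<zero>\<^bsub>T\<^esub> = \<zero>\<^bsub>S\<^esub>"
proof -
  interpret T: module R T by fact
  interpret S: module R S by fact
  have "f (\<zero>\<^bsub>R\<^esub> \<odot>\<^bsub>T\<^esub> \<zero>\<^bsub>T\<^esub>) = \<zero>\<^bsub>R\<^esub> \<odot>\<^bsub>S\<^esub> f \<zero>\<^bsub>T\<^esub>" "f \<zero>\<^bsub>T\<^esub> \<in> carrier S"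
    using assms(3) unfolding linear_maps_def by blast+
  then show ?thesis by simp
qed

lemma linear_maps_finsum:
  assumes "module R T" "module R S" "f \<in> linear_maps R T S" "finite F" "g \<in> F \<rightarrow> carrier T"
  shows "f (\<Oplus>\<^bsub>T\<^esub>i\<in>F. g i) = (\<Oplus>\<^bsub>S\<^esub>i\<in>F. f (g i))"
proof -
  interpret T: module R T by fact
  interpret S: module R S by fact
  show ?thesis using assms(4,5)
  proof induction
    case empty
    then show ?case by (simp add: linear_maps_zero[OF assms(1-3)])
  next
    case (insert i F)
    have "f (x \<oplus>\<^bsub>T\<^esub> y) = f x \<oplus>\<^bsub>S\<^esub> f y"
      if "x \<in> carrier T" "y \<in> carrier T" for x y
      using assms(3) that by (auto simp: linear_maps_def)
    moreover have "f x \<in> carrier S" if "x \<in> carrier T" for x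
      using assms(3) that by (auto simp: linear_maps_def)
    moreover have "g i \<in> carrier T" "g \<in> F \<rightarrow> carrier T" using insert.prems by auto
    ultimately show ?case using insert by (simp add: Pi_def T.M.finsum_closed)
  qed
qed

text \<open>With one argument fixed, preservation of zero and of finite sums carries over from
  linear maps.\<close>

lemma bilinear_map_linear:
  assumes "bilinear_map R M N L \<phi>"
  shows "y \<in> carrier N \<Longrightarrow> (\<lambda>x. \<phi> (x, y)) \<in> linear_maps R M L"
    and "x \<in> carrier M \<Longrightarrow> (\<lambda>y. \<phi> (x, y)) \<in> linear_maps R N L"
  using assms by (auto simp: bilinear_map_def linear_maps_def)

lemma (in abelian_monoid) finsum_swap:
  assumes "finite A" "finite B" "\<And>i j. i \<in> A \<Longrightarrow> j \<in> B \<Longrightarrow> g i j \<in> carrier G"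
  shows "(\<Oplus>i\<in>A. \<Oplus>j\<in>B. g i j) = (\<Oplus>j\<in>B. \<Oplus>i\<in>A. g i j)"
  using assms(1,3)
proof induction
  case empty
  then show ?case by simp
next
  case (insert i A)
  have "(\<Oplus>j\<in>B. \<Oplus>i\<in>insert i A. g i j) = (\<Oplus>j\<in>B. g i j \<oplus> (\<Oplus>i\<in>A. g i j))"
    using insert by (intro finsum_cong') (auto simp: Pi_def)
  also have "\<dots> = (\<Oplus>j\<in>B. g i j) \<oplus> (\<Oplus>j\<in>B. \<Oplus>i\<in>A. g i j)"
    using insert by (intro finsum_addf) (auto simp: Pi_def)
  finally show ?case using insert by (simp add: Pi_def)
qed

section \<open>From a vanishing tensor sum to the coefficients\<close>

lemma tensor_sum_zero_imp_syzygy_span: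
  fixes R :: "('r, 'x) ring_scheme" and M :: "('r, 'm, 'y) module_scheme"
    and N :: "('r, 'n, 'z) module_scheme" and T :: "('r, 't, 'w) module_scheme" and I :: "'i set"
  assumes tensor: "is_tensor_product R M N T \<phi>" and gen: "generates R N (n ` I)"
    and F: "finite F" "F \<subseteq> I" "m \<in> F \<rightarrow> carrier M"
    and eq: "(\<Oplus>\<^bsub>T\<^esub>i\<in>F. \<phi> (m i, n i)) = \<zero>\<^bsub>T\<^esub>"
  shows "(\<lambda>i. if i \<in> F then m i else \<zero>\<^bsub>M\<^esub>) \<in> syzygy_span R M N I n"
proof -
  have M: "module R M" and N: "module R N" and T: "module R T" and bil: "bilinear_map R M N T \<phi>"
    using tensor by (auto simp: is_tensor_product_def tensor_product_wrt_def)
  interpret M: module R M by (rule M)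
  interpret N: module R N by (rule N)
  have n: "n \<in> I \<rightarrow> carrier N" using gen by (auto simp: generates_def)
  let ?P = "pointwise_module M :: ('r, 'i \<Rightarrow> 'm) module"
  define K where "K = syzygy_span R M N I n"
  define S where "S = quotient_module ?P K"
  have P: "module R ?P" by (rule module_pointwise_module[OF M])
  interpret P: module R ?P by (rule P)
  have K: "submodule K R ?P" unfolding K_def by (rule submodule_syzygy_span[OF M])
  have S: "module R S" unfolding S_def by (rule module_quotient_module[OF P K])
  interpret S: module R S by (rule S)
  define q where "q v = K +>\<^bsub>?P\<^esub> v" for v
  have qc: "q v \<in> carrier S" if "\<And>i. v i \<in> carrier M" for v
    using that unfolding q_def S_def by (simp add: carrier_quotient_module[OF P K])
  have q_add: "q u \<oplus>\<^bsub>S\<^esub> q v = q (\<lambda>i. u i \<oplus>\<^bsub>M\<^esub> v i)"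
    if "\<And>i. u i \<in> carrier M" "\<And>i. v i \<in> carrier M" for u v
    using that add_quotient_module[OF P K, of u v] unfolding q_def S_def by simp
  have q_smult: "r \<odot>\<^bsub>S\<^esub> q v = q (\<lambda>i. r \<odot>\<^bsub>M\<^esub> v i)"
    if "r \<in> carrier R" "\<And>i. v i \<in> carrier M" for r v
    using that smult_quotient_module[OF P K, of r v] unfolding q_def S_def by simp
  have q_zero: "\<zero>\<^bsub>S\<^esub> = q (\<lambda>_. \<zero>\<^bsub>M\<^esub>)"
    unfolding q_def S_def using zero_quotient_module[OF P K] by simp
  have minus: "u \<ominus>\<^bsub>?P\<^esub> v = (\<lambda>i. u i \<ominus>\<^bsub>M\<^esub> v i)"
    if "\<And>i. u i \<in> carrier M" "\<And>i. v i \<in> carrier M" for u v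
  proof -
    \<comment> \<open>The inverse in the power is defined abstractly; uniqueness of inverses
      identifies it with the pointwise one.\<close>
    have "(\<lambda>i. \<ominus>\<^bsub>M\<^esub> v i) = \<ominus>\<^bsub>?P\<^esub> v"
      using that by (intro P.M.minus_equality[symmetric]) (auto simp: M.M.l_neg)
    then show ?thesis by (metis (no_types) a_minus_def pointwise_module_simps(3))
  qed
  have q_eq: "q u = q v \<longleftrightarrow> (\<lambda>i. u i \<ominus>\<^bsub>M\<^esub> v i) \<in> K"
    if "\<And>i. u i \<in> carrier M" "\<And>i. v i \<in> carrier M" for u v
    using that coset_eq_iff[OF P K, of u v] minus[of u v] unfolding q_def by simp
  \<comment> \<open>One coefficient function is chosen for each \<open>y\<close>. The choice need
    not be additive in \<open>y\<close>; only its effect modulo \<open>K\<close> is linear.\<close>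
  define rep where "rep y = (SOME c. c \<in> fin_coeffs R I \<and> lin_comb R N n c = y)" for y
  have rep: "rep y \<in> fin_coeffs R I" "lin_comb R N n (rep y) = y" if "y \<in> carrier N" for y
    using someI_ex[of "\<lambda>c. c \<in> fin_coeffs R I \<and> lin_comb R N n c = y"]
      generates_imp_lin_comb[OF N n gen that] unfolding rep_def by metis+
  define \<psi> where "\<psi> = (\<lambda>(x, y). q (\<lambda>i. rep y i \<odot>\<^bsub>M\<^esub> x))"
  have cR: "c i \<in> carrier R" if "c \<in> fin_coeffs R I" for c i
    using that by (simp add: fin_coeffs_def)
  \<comment> \<open>The class is independent of the choice: the chosen coefficients and
    \<open>c\<close> represent the same element, so their difference is a syzygy, and that syzygy
    times \<open>x\<close> is a single generator of \<open>K\<close>.\<close>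
  have \<psi>: "\<psi> (x, lin_comb R N n c) = q (\<lambda>i. c i \<odot>\<^bsub>M\<^esub> x)"
    if x: "x \<in> carrier M" and c: "c \<in> fin_coeffs R I" for x c
  proof -
    let ?y = "lin_comb R N n c"
    have y: "?y \<in> carrier N" by (rule lin_comb_closed[OF N n c])
    note d = rep[OF y]
    let ?e = "\<lambda>i. rep ?y i \<oplus>\<^bsub>R\<^esub> (\<ominus>\<^bsub>R\<^esub> \<one>\<^bsub>R\<^esub>) \<otimes>\<^bsub>R\<^esub> c i"
    have e: "(\<lambda>i. (\<ominus>\<^bsub>R\<^esub> \<one>\<^bsub>R\<^esub>) \<otimes>\<^bsub>R\<^esub> c i) \<in> fin_coeffs R I"
      by (rule fin_coeffs_smult[OF N n c]) simp
    have "lin_comb R N n ?e = \<zero>\<^bsub>N\<^esub>"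
      using y d(2) by (simp add: lin_comb_add[OF N n d(1) e] lin_comb_smult[OF N n c]
          N.smult_l_minus N.M.r_neg)
    \<comment> \<open>The trailing zero is the base case of \<open>syzygy_span\<close>, to which
      this one column is added.\<close>
    then have "(\<lambda>i. ?e i \<odot>\<^bsub>M\<^esub> x \<oplus>\<^bsub>M\<^esub> \<zero>\<^bsub>M\<^esub>) \<in> K"
      unfolding K_def using x fin_coeffs_add[OF N n d(1) e]
      by (intro syzygy_span.add[OF syzygy_span.zero])
    moreover have "?e i \<odot>\<^bsub>M\<^esub> x \<oplus>\<^bsub>M\<^esub> \<zero>\<^bsub>M\<^esub> = rep ?y i \<odot>\<^bsub>M\<^esub> x \<ominus>\<^bsub>M\<^esub> c i \<odot>\<^bsub>M\<^esub> x" for i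
      using x cR[OF c, of i] cR[OF d(1), of i]
      by (simp add: M.smult_l_distr M.smult_l_minus M.l_minus a_minus_def)
    ultimately show ?thesis
      using x cR[OF c] cR[OF d(1)] by (simp add: \<psi>_def q_eq)
  qed
  \<comment> \<open>Linearity in the first argument is computed with \<open>rep y\<close> fixed. In
    the second, the coefficients chosen for a sum or a multiple may differ from the sum or multiple
    of the chosen ones, but independence of the choice gives the same class.\<close>
  have \<psi>_bil: "bilinear_map R M N S \<psi>"
    unfolding bilinear_map_def
  proof (intro conjI ballI)
    show "\<psi> \<in> carrier M \<times> carrier N \<rightarrow> carrier S"
      using cR rep(1) by (auto simp: \<psi>_def intro!: qc)
  next
    fix r x y assume r: "r \<in> carrier R" and x: "x \<in> carrier M" and y: "y \<in> carrier N"
    note c = cR[OF rep(1)[OF y]]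
    show "\<psi> (r \<odot>\<^bsub>M\<^esub> x, y) = r \<odot>\<^bsub>S\<^esub> \<psi> (x, y)"
      using r x c by (simp add: \<psi>_def q_smult M.smult_assoc1[symmetric] M.m_comm)
    show "\<psi> (x, r \<odot>\<^bsub>N\<^esub> y) = r \<odot>\<^bsub>S\<^esub> \<psi> (x, y)"
      using \<psi>[OF x fin_coeffs_smult[OF N n rep(1)[OF y] r]] r x c
        lin_comb_smult[OF N n rep(1)[OF y] r] rep(2)[OF y]
      by (simp add: \<psi>_def q_smult M.smult_assoc1)
  next
    fix x x' y assume x: "x \<in> carrier M" "x' \<in> carrier M" and y: "y \<in> carrier N"
    show "\<psi> (x \<oplus>\<^bsub>M\<^esub> x', y) = \<psi> (x, y) \<oplus>\<^bsub>S\<^esub> \<psi> (x', y)"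
      using x cR[OF rep(1)[OF y]] by (simp add: \<psi>_def q_add M.smult_r_distr)
  next
    fix x y y' assume x: "x \<in> carrier M" and y: "y \<in> carrier N" "y' \<in> carrier N"
    note c = rep(1)[OF y(1)] rep(1)[OF y(2)]
    show "\<psi> (x, y \<oplus>\<^bsub>N\<^esub> y') = \<psi> (x, y) \<oplus>\<^bsub>S\<^esub> \<psi> (x, y')"
      using \<psi>[OF x fin_coeffs_add[OF N n c]] x cR[OF c(1)] cR[OF c(2)]
        lin_comb_add[OF N n c] rep(2)[OF y(1)] rep(2)[OF y(2)]
      by (simp add: \<psi>_def q_add M.smult_l_distr)
  qed
  \<comment> \<open>The elements of the quotient are sets of functions, a type other than the one
    tested in \<open>is_tensor_product\<close>, so the universal property is first transferred to
    it.\<close>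
  have "tensor_product_wrt TYPE(('i \<Rightarrow> 'm) set) R M N T \<phi>"
    by (rule is_tensor_product_universal[OF tensor])
  then obtain f where f: "f \<in> linear_maps R T S"
    and f\<phi>: "\<And>p. p \<in> carrier M \<times> carrier N \<Longrightarrow> \<psi> p = f (\<phi> p)"
    using S \<psi>_bil unfolding tensor_product_wrt_def by blast
  have \<phi>c: "(\<lambda>i. \<phi> (m i, n i)) \<in> F \<rightarrow> carrier T"
    using F n bil by (fastforce simp: bilinear_map_def)
  have "(\<Oplus>\<^bsub>S\<^esub>i\<in>F. \<psi> (m i, n i)) = (\<Oplus>\<^bsub>S\<^esub>i\<in>F. f (\<phi> (m i, n i)))"
  proof (rule S.M.finsum_cong')
    show "(\<lambda>i. f (\<phi> (m i, n i))) \<in> F \<rightarrow> carrier S"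
      using \<phi>c f by (auto simp: linear_maps_def)
    show "\<psi> (m i, n i) = f (\<phi> (m i, n i))" if "i \<in> F" for i
      using that F n by (intro f\<phi>) auto
  qed simp
  also have "\<dots> = f (\<Oplus>\<^bsub>T\<^esub>i\<in>F. \<phi> (m i, n i))"
    by (rule linear_maps_finsum[OF T S f F(1) \<phi>c, symmetric])
  also have "\<dots> = \<zero>\<^bsub>S\<^esub>" using eq linear_maps_zero[OF T S f] by simp
  \<comment> \<open>With unit coefficients for \<open>n l\<close>, the term
    \<open>\<psi> (m l, n l)\<close> is the class of the function with value \<open>m l\<close> at
    \<open>l\<close> and zero elsewhere. Summing over \<open>F\<close> assembles the whole
    family.\<close>
  also have "(\<Oplus>\<^bsub>S\<^esub>i\<in>F. \<psi> (m i, n i)) = q (\<lambda>i. if i \<in> F then m i else \<zero>\<^bsub>M\<^esub>)"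
    using F
  proof induction
    case empty
    then show ?case by (simp add: q_zero)
  next
    case (insert l F)
    have c: "m i \<in> carrier M" "n i \<in> carrier N" if "i \<in> insert l F" for i
      using insert.prems n that by auto
    have \<psi>c: "\<psi> (m i, n i) \<in> carrier S" if "i \<in> insert l F" for i
      using \<psi>_bil c[OF that] by (auto simp: bilinear_map_def)
    have "l \<in> I" using insert by simp
    then have "\<psi> (m l, n l) = q (\<lambda>i. (if i = l then \<one>\<^bsub>R\<^esub> else \<zero>\<^bsub>R\<^esub>) \<odot>\<^bsub>M\<^esub> m l)"
      using \<psi>[OF c(1)[of l] lin_comb_unit(1)[OF N n, of l]] lin_comb_unit(2)[OF N n, of l] by simp
    moreover have "(\<Oplus>\<^bsub>S\<^esub>i\<in>F. \<psi> (m i, n i)) = q (\<lambda>i. if i \<in> F then m i else \<zero>\<^bsub>M\<^esub>)"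
      using insert by auto
    ultimately have "(\<Oplus>\<^bsub>S\<^esub>i\<in>insert l F. \<psi> (m i, n i)) =
        q (\<lambda>i. (if i = l then \<one>\<^bsub>R\<^esub> else \<zero>\<^bsub>R\<^esub>) \<odot>\<^bsub>M\<^esub> m l \<oplus>\<^bsub>M\<^esub> (if i \<in> F then m i else \<zero>\<^bsub>M\<^esub>))"
      using insert.hyps \<psi>c c by (subst S.M.finsum_insert) (auto simp: q_add intro!: qc)
    also have "(\<lambda>i. (if i = l then \<one>\<^bsub>R\<^esub> else \<zero>\<^bsub>R\<^esub>) \<odot>\<^bsub>M\<^esub> m l \<oplus>\<^bsub>M\<^esub> (if i \<in> F then m i else \<zero>\<^bsub>M\<^esub>)) =
        (\<lambda>i. if i \<in> insert l F then m i else \<zero>\<^bsub>M\<^esub>)"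
      using insert.hyps c by (auto simp: fun_eq_iff)
    finally show ?case .
  qed
  \<comment> \<open>Membership in \<open>K\<close> is read off by comparing with the class of the
    zero function.\<close>
  finally have "q (\<lambda>i. if i \<in> F then m i else \<zero>\<^bsub>M\<^esub>) = q (\<lambda>_. \<zero>\<^bsub>M\<^esub>)" by (simp add: q_zero)
  then have "(\<lambda>i. (if i \<in> F then m i else \<zero>\<^bsub>M\<^esub>) \<ominus>\<^bsub>M\<^esub> \<zero>\<^bsub>M\<^esub>) \<in> K"
    using F(3) by (subst (asm) q_eq) auto
  moreover have "(\<lambda>i. (if i \<in> F then m i else \<zero>\<^bsub>M\<^esub>) \<ominus>\<^bsub>M\<^esub> \<zero>\<^bsub>M\<^esub>) = (\<lambda>i. if i \<in> F then m i else \<zero>\<^bsub>M\<^esub>)"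
    using F(3) by (auto simp: fun_eq_iff a_minus_def Pi_iff)
  ultimately show ?thesis by (simp add: K_def)
qed

section \<open>From the coefficients to a vanishing tensor sum\<close>

text \<open>Insert the row relations in the first argument, move each \<open>a i j\<close> to the
  second by bilinearity, and sum over \<open>i\<close> first: the column relations leave
  \<open>\<phi> (m' j, 0) = 0\<close>.\<close>

lemma bilinear_sum_eq_zero:
  fixes k :: nat
  assumes M: "module R M" and N: "module R N" and T: "module R T" and bil: "bilinear_map R M N T \<phi>"
    and n: "n \<in> I \<rightarrow> carrier N" and F: "finite F" "F \<subseteq> I" "m \<in> F \<rightarrow> carrier M"
    and m': "\<And>j. j < k \<Longrightarrow> m' j \<in> carrier M"
    and a: "\<And>i j. i \<in> I \<Longrightarrow> j < k \<Longrightarrow> a i j \<in> carrier R"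
    and fin: "\<And>j. j < k \<Longrightarrow> finite {i\<in>I. a i j \<noteq> \<zero>\<^bsub>R\<^esub>}"
    and row: "\<And>i. i \<in> I \<Longrightarrow> (\<Oplus>\<^bsub>M\<^esub>j\<in>{..<k}. a i j \<odot>\<^bsub>M\<^esub> m' j) = (if i \<in> F then m i else \<zero>\<^bsub>M\<^esub>)"
    and col: "\<And>j. j < k \<Longrightarrow> (\<Oplus>\<^bsub>N\<^esub>i\<in>{i\<in>I. a i j \<noteq> \<zero>\<^bsub>R\<^esub>}. a i j \<odot>\<^bsub>N\<^esub> n i) = \<zero>\<^bsub>N\<^esub>"
  shows "(\<Oplus>\<^bsub>T\<^esub>i\<in>F. \<phi> (m i, n i)) = \<zero>\<^bsub>T\<^esub>"
proof -
  interpret M: module R M by (rule M)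
  interpret N: module R N by (rule N)
  interpret T: module R T by (rule T)
  \<comment> \<open>One finite set containing \<open>F\<close> and the supports of all columns
    serves as the common range of \<open>i\<close>, even when \<open>I\<close> is infinite.\<close>
  define B where "B = F \<union> (\<Union>j<k. {i\<in>I. a i j \<noteq> \<zero>\<^bsub>R\<^esub>})"
  have B: "finite B" "B \<subseteq> I" using F fin by (auto simp: B_def)
  have nB: "n i \<in> carrier N" if "i \<in> B" for i using that B n by auto
  have aB: "a i j \<in> carrier R" if "i \<in> B" "j < k" for i j using that B a by auto
  have \<phi>c: "\<phi> (x, y) \<in> carrier T" if "x \<in> carrier M" "y \<in> carrier N" for x y
    using bil that by (auto simp: bilinear_map_def)
  have \<phi>s: "\<phi> (r \<odot>\<^bsub>M\<^esub> x, y) = \<phi> (x, r \<odot>\<^bsub>N\<^esub> y)" if "r \<in> carrier R" "x \<in> carrier M" "y \<in> carrier N" for r x y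
    using bil that by (auto simp: bilinear_map_def)
  note left = bilinear_map_linear(1)[OF bil] and right = bilinear_map_linear(2)[OF bil]
  let ?u = "\<lambda>i. if i \<in> F then m i else \<zero>\<^bsub>M\<^esub>"
  \<comment> \<open>Outside \<open>F\<close> the summand is \<open>\<phi> (0, n i) = 0\<close>, so
    enlarging the range changes nothing.\<close>
  have "(\<Oplus>\<^bsub>T\<^esub>i\<in>F. \<phi> (m i, n i)) = (\<Oplus>\<^bsub>T\<^esub>i\<in>B. \<phi> (?u i, n i))"
  proof (rule T.M.add.finprod_mono_neutral_cong_left)
    show "(\<lambda>i. \<phi> (?u i, n i)) \<in> B \<rightarrow> carrier T"
      using F(3) nB by (auto intro!: \<phi>c)
    show "\<phi> (?u i, n i) = \<zero>\<^bsub>T\<^esub>" if "i \<in> B - F" for i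
      using that linear_maps_zero[OF M T left[OF nB]] by simp
  qed (use B in \<open>auto simp: B_def\<close>)
  also have "\<dots> = (\<Oplus>\<^bsub>T\<^esub>i\<in>B. \<Oplus>\<^bsub>T\<^esub>j\<in>{..<k}. \<phi> (m' j, a i j \<odot>\<^bsub>N\<^esub> n i))"
  proof (rule T.M.finsum_cong')
    fix i assume i: "i \<in> B"
    \<comment> \<open>The row relation is also used at indices of \<open>B\<close> outside
      \<open>F\<close>, where it says that the row sum is zero.\<close>
    have "?u i = (\<Oplus>\<^bsub>M\<^esub>j\<in>{..<k}. a i j \<odot>\<^bsub>M\<^esub> m' j)" using row[of i] i B by auto
    then have "\<phi> (?u i, n i) = (\<Oplus>\<^bsub>T\<^esub>j\<in>{..<k}. \<phi> (a i j \<odot>\<^bsub>M\<^esub> m' j, n i))"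
      using linear_maps_finsum[OF M T left[OF nB[OF i]], of "{..<k}" "\<lambda>j. a i j \<odot>\<^bsub>M\<^esub> m' j"] aB[OF i] m' by auto
    also have "\<dots> = (\<Oplus>\<^bsub>T\<^esub>j\<in>{..<k}. \<phi> (m' j, a i j \<odot>\<^bsub>N\<^esub> n i))"
      using aB[OF i] m' nB[OF i] by (intro T.M.finsum_cong') (auto simp: \<phi>s \<phi>c)
    finally show "\<phi> (?u i, n i) = (\<Oplus>\<^bsub>T\<^esub>j\<in>{..<k}. \<phi> (m' j, a i j \<odot>\<^bsub>N\<^esub> n i))" .
  qed (use aB m' nB in \<open>auto intro!: T.M.finsum_closed \<phi>c\<close>)
  also have "\<dots> = (\<Oplus>\<^bsub>T\<^esub>j\<in>{..<k}. \<Oplus>\<^bsub>T\<^esub>i\<in>B. \<phi> (m' j, a i j \<odot>\<^bsub>N\<^esub> n i))"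
    using B aB m' nB by (intro T.M.finsum_swap) (auto intro!: \<phi>c)
  also have "\<dots> = (\<Oplus>\<^bsub>T\<^esub>j\<in>{..<k}. \<zero>\<^bsub>T\<^esub>)"
  proof (rule T.M.finsum_cong')
    fix j assume "j \<in> {..<k}"
    then have j: "j < k" by simp
    \<comment> \<open>Indices of \<open>B\<close> beyond the support of column \<open>j\<close>
      contribute zero, so the column relation holds over \<open>B\<close>.\<close>
    have "(\<Oplus>\<^bsub>N\<^esub>i\<in>{i\<in>I. a i j \<noteq> \<zero>\<^bsub>R\<^esub>}. a i j \<odot>\<^bsub>N\<^esub> n i) = (\<Oplus>\<^bsub>N\<^esub>i\<in>B. a i j \<odot>\<^bsub>N\<^esub> n i)"
    proof (rule N.M.add.finprod_mono_neutral_cong_left)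
      show "a i j \<odot>\<^bsub>N\<^esub> n i = \<zero>\<^bsub>N\<^esub>" if "i \<in> B - {i\<in>I. a i j \<noteq> \<zero>\<^bsub>R\<^esub>}" for i
        using that B(2) nB[of i] by auto
      show "(\<lambda>i. a i j \<odot>\<^bsub>N\<^esub> n i) \<in> B \<rightarrow> carrier N" using j aB nB by auto
    qed (use B j in \<open>auto simp: B_def\<close>)
    then have "(\<Oplus>\<^bsub>N\<^esub>i\<in>B. a i j \<odot>\<^bsub>N\<^esub> n i) = \<zero>\<^bsub>N\<^esub>" using col[OF j] by simp
    moreover have "(\<Oplus>\<^bsub>T\<^esub>i\<in>B. \<phi> (m' j, a i j \<odot>\<^bsub>N\<^esub> n i)) = \<phi> (m' j, \<Oplus>\<^bsub>N\<^esub>i\<in>B. a i j \<odot>\<^bsub>N\<^esub> n i)"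
      using aB nB j by (intro linear_maps_finsum[OF N T right[OF m'[OF j]] B(1), symmetric]) auto
    ultimately show "(\<Oplus>\<^bsub>T\<^esub>i\<in>B. \<phi> (m' j, a i j \<odot>\<^bsub>N\<^esub> n i)) = \<zero>\<^bsub>T\<^esub>"
      using linear_maps_zero[OF N T right[OF m'[OF j]]] by simp
  qed auto
  finally show ?thesis by simp
qed

section \<open>The criterion in both directions\<close>

theorem proposition3p69:
  fixes R :: "('r, 'x) ring_scheme"
    and M :: "('r, 'm, 'y) module_scheme"
    and N :: "('r, 'n, 'z) module_scheme"
    and T :: "('r, 't, 'w) module_scheme"
    and \<phi> :: "'m \<times> 'n \<Rightarrow> 't"
    and I :: "'i set" and n :: "'i \<Rightarrow> 'n"
    and F :: "'i set" and m :: "'i \<Rightarrow> 'm"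
  assumes "cring R" and "module R M" and "module R N"
    and "is_tensor_product R M N T \<phi>"
    and "generates R N (n ` I)"
    and "finite F" and "F \<subseteq> I" and "m \<in> F \<rightarrow> carrier M"
  shows "(\<Oplus>\<^bsub>T\<^esub>i\<in>F. \<phi> (m i, n i)) = \<zero>\<^bsub>T\<^esub> \<longleftrightarrow>
    (\<exists>(k::nat) (m' :: nat \<Rightarrow> 'm) (a :: 'i \<Rightarrow> nat \<Rightarrow> 'r).
       (\<forall>j<k. m' j \<in> carrier M) \<and>
       (\<forall>i\<in>I. \<forall>j<k. a i j \<in> carrier R) \<and>
       (\<forall>j<k. finite {i\<in>I. a i j \<noteq> \<zero>\<^bsub>R\<^esub>}) \<and>
       (\<forall>i\<in>I. (\<Oplus>\<^bsub>M\<^esub>j\<in>{..<k}. a i j \<odot>\<^bsub>M\<^esub> m' j) = (if i \<in> F then m i else \<zero>\<^bsub>M\<^esub>)) \<and>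
       (\<forall>j<k. (\<Oplus>\<^bsub>N\<^esub>i\<in>{i\<in>I. a i j \<noteq> \<zero>\<^bsub>R\<^esub>}. a i j \<odot>\<^bsub>N\<^esub> n i) = \<zero>\<^bsub>N\<^esub>))"
proof -
  note M = \<open>module R M\<close> and N = \<open>module R N\<close>
  have T: "module R T" and bil: "bilinear_map R M N T \<phi>"
    using assms(4) by (auto simp: is_tensor_product_def tensor_product_wrt_def)
  have n: "n \<in> I \<rightarrow> carrier N" using assms(5) by (auto simp: generates_def)
  show ?thesis
  proof (intro iffI; (elim exE conjE)?)
    assume "(\<Oplus>\<^bsub>T\<^esub>i\<in>F. \<phi> (m i, n i)) = \<zero>\<^bsub>T\<^esub>"
    then have "(\<lambda>i. if i \<in> F then m i else \<zero>\<^bsub>M\<^esub>) \<in> syzygy_span R M N I n"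
      using assms by (intro tensor_sum_zero_imp_syzygy_span)
    then obtain k :: nat and m' a where h:
      "\<forall>j<k. m' j \<in> carrier M \<and> a j \<in> fin_coeffs R I \<and> lin_comb R N n (a j) = \<zero>\<^bsub>N\<^esub>"
      and rows: "\<forall>i. (if i \<in> F then m i else \<zero>\<^bsub>M\<^esub>) = (\<Oplus>\<^bsub>M\<^esub>j\<in>{..<k}. a j i \<odot>\<^bsub>M\<^esub> m' j)"
      by (rule syzygy_spanE[OF M])
    \<comment> \<open>The coefficients vanish off \<open>I\<close>, so the sums in
      \<open>lin_comb\<close> have the same range as the column sums of the claim.\<close>
    have supp: "{i \<in> I. a j i \<noteq> \<zero>\<^bsub>R\<^esub>} = {i. a j i \<noteq> \<zero>\<^bsub>R\<^esub>}" if "j < k" for j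
      using h that fin_coeffsD(3)[of "a j" R I] by auto
    show "\<exists>(k::nat) (m' :: nat \<Rightarrow> 'm) (a :: 'i \<Rightarrow> nat \<Rightarrow> 'r).
       (\<forall>j<k. m' j \<in> carrier M) \<and>
       (\<forall>i\<in>I. \<forall>j<k. a i j \<in> carrier R) \<and>
       (\<forall>j<k. finite {i\<in>I. a i j \<noteq> \<zero>\<^bsub>R\<^esub>}) \<and>
       (\<forall>i\<in>I. (\<Oplus>\<^bsub>M\<^esub>j\<in>{..<k}. a i j \<odot>\<^bsub>M\<^esub> m' j) = (if i \<in> F then m i else \<zero>\<^bsub>M\<^esub>)) \<and>
       (\<forall>j<k. (\<Oplus>\<^bsub>N\<^esub>i\<in>{i\<in>I. a i j \<noteq> \<zero>\<^bsub>R\<^esub>}. a i j \<odot>\<^bsub>N\<^esub> n i) = \<zero>\<^bsub>N\<^esub>)"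
      \<comment> \<open>The matrix is transposed, since the columns obtained above are indexed by
        \<open>j\<close> first.\<close>
      using h by (intro exI[of _ k] exI[of _ m'] exI[of _ "\<lambda>i j. a j i"])
        (simp add: supp rows[rule_format, symmetric] lin_comb_def fin_coeffs_def)
  next
    fix k :: nat and m' :: "nat \<Rightarrow> 'm" and a :: "'i \<Rightarrow> nat \<Rightarrow> 'r"
    assume "\<forall>j<k. m' j \<in> carrier M" "\<forall>i\<in>I. \<forall>j<k. a i j \<in> carrier R"
      "\<forall>j<k. finite {i\<in>I. a i j \<noteq> \<zero>\<^bsub>R\<^esub>}"
      "\<forall>i\<in>I. (\<Oplus>\<^bsub>M\<^esub>j\<in>{..<k}. a i j \<odot>\<^bsub>M\<^esub> m' j) = (if i \<in> F then m i else \<zero>\<^bsub>M\<^esub>)"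
      "\<forall>j<k. (\<Oplus>\<^bsub>N\<^esub>i\<in>{i\<in>I. a i j \<noteq> \<zero>\<^bsub>R\<^esub>}. a i j \<odot>\<^bsub>N\<^esub> n i) = \<zero>\<^bsub>N\<^esub>"
    then show "(\<Oplus>\<^bsub>T\<^esub>i\<in>F. \<phi> (m i, n i)) = \<zero>\<^bsub>T\<^esub>"
      using assms(6-8) by (intro bilinear_sum_eq_zero[OF M N T bil n, of F m k m' a]) auto
  qed
qed

end
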